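(* Let $\Gamma_n=\{P_1,\ldots,P_k\}$ with $k\ge 3$ and let $Q$ be a minimal witness of $\Gamma_n$. Then $|Q|\le n(k-1)$.
   Context: $\Gamma_n$ is a set of $k$ pairwise non-isomorphic (unlabelled) posets each of size $n$. A downset is a downward-closed subset; $D_n(Q)$ is the set of downsets of $Q$ of size $n$ up to isomorphism. $Q$ is a witness of $\Gamma_n$ if $D_n(Q)=\Gamma_n$, and a minimal witness if no proper downset of $Q$ is a witness of $\Gamma_n$. *)

theory Defs
  imports Main
begin

type_synonym 'a poset = "'a set \<times> ('a \<Rightarrow> 'a \<Rightarrow> bool)"

definition is_poset :: "'a poset \<Rightarrow> bool" where
  "is_poset P \<longleftrightarrow>
     (\<forall>x\<in>fst P. snd P x x) \<and>
     (\<forall>x\<in>fst P. \<forall>y\<in>fst P. snd P x y \<and> snd P y x \<longrightarrow> x = y) \<and>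
     (\<forall>x\<in>fst P. \<forall>y\<in>fst P. \<forall>z\<in>fst P. snd P x y \<and> snd P y z \<longrightarrow> snd P x z)"

definition poset_iso :: "'a poset \<Rightarrow> 'b poset \<Rightarrow> bool" where
  "poset_iso P R \<longleftrightarrow>
     (\<exists>f. bij_betw f (fst P) (fst R) \<and>
          (\<forall>x\<in>fst P. \<forall>y\<in>fst P. snd P x y \<longleftrightarrow> snd R (f x) (f y)))"

definition is_downset :: "'a poset \<Rightarrow> 'a set \<Rightarrow> bool" where
  "is_downset Q D \<longleftrightarrow> D \<subseteq> fst Q \<and> (\<forall>x\<in>D. \<forall>y\<in>fst Q. snd Q y x \<longrightarrow> y \<in> D)"

definition subposet :: "'a poset \<Rightarrow> 'a set \<Rightarrow> 'a poset" where
  "subposet Q D = (D, snd Q)"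

text \<open>Q is a witness of Gamma (a set of posets of size n): D_n(Q) = Gamma up to isomorphism.\<close>
definition is_witness :: "'b poset set \<Rightarrow> nat \<Rightarrow> 'a poset \<Rightarrow> bool" where
  "is_witness \<Gamma> n Q \<longleftrightarrow>
     (\<forall>D. is_downset Q D \<and> finite D \<and> card D = n \<longrightarrow> (\<exists>P\<in>\<Gamma>. poset_iso (subposet Q D) P)) \<and>
     (\<forall>P\<in>\<Gamma>. \<exists>D. is_downset Q D \<and> finite D \<and> card D = n \<and> poset_iso (subposet Q D) P)"

definition is_minimal_witness :: "'b poset set \<Rightarrow> nat \<Rightarrow> 'a poset \<Rightarrow> bool" where
  "is_minimal_witness \<Gamma> n Q \<longleftrightarrow>
     is_witness \<Gamma> n Q \<and>
     (\<forall>D. is_downset Q D \<and> D \<noteq> fst Q \<longrightarrow> \<not> is_witness \<Gamma> n (subposet Q D))"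

end

theory Submission
  imports Defs
begin

(* Take downsets A and B of size n realizing two distinct types. Exchanging a maximal element of
   A - B for a minimal element of B - A again gives a downset of size n; iterating, the type must
   change at some step, so two distinct types are realized by downsets with |A - B| <= 1, i.e.
   inside n + 1 elements. A downset C of a third type either meets A \<union> B, or it is disjoint
   from it; then C with a maximal element replaced by a minimal element a of A \<inter> B is a
   downset E, and whatever type E has, three distinct types fit into 2n elements. Adding one
   realizing downset for each of the remaining k - 3 types gives a downset of size at most
   n(k - 1) which is still a witness, hence all of Q by minimality. *)

definition realizes :: "'a poset \<Rightarrow> nat \<Rightarrow> 'a set \<Rightarrow> 'b poset \<Rightarrow> bool" where
  "realizes Q n D P \<longleftrightarrow> is_downset Q D \<and> card D = n \<and> poset_iso (subposet Q D) P"

lemma card_Un_Diff: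
  assumes "finite A" "finite B"
  shows "card (A \<union> B) = card B + card (A - B)"
proof -
  have "card (B \<union> (A - B)) = card B + card (A - B)"
    by (rule card_Un_disjoint) (use assms in auto)
  then show ?thesis
    by (metis Un_Diff_cancel Un_commute)
qed

lemma obtain_element_outside:
  assumes "finite F" "card F < card A"
  obtains x where "x \<in> A" "x \<notin> F"
  using assms card_mono by (metis not_le subsetI)

lemma finite_has_minimal_wrt:
  assumes "finite X" "X \<noteq> {}"
    and "\<And>x y. x \<in> X \<Longrightarrow> y \<in> X \<Longrightarrow> R x y \<Longrightarrow> R y x \<Longrightarrow> x = y"
    and "\<And>x y z. x \<in> X \<Longrightarrow> y \<in> X \<Longrightarrow> z \<in> X \<Longrightarrow> R x y \<Longrightarrow> R y z \<Longrightarrow> R x z"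
  shows "\<exists>m\<in>X. \<forall>y\<in>X. R y m \<longrightarrow> y = m"
  using assms
proof (induction X rule: finite_ne_induct)
  case (singleton x)
  then show ?case
    by blast
next
  case (insert x F)
  note antisym = insert.prems(1) and trans = insert.prems(2)
  obtain m where m: "m \<in> F" "\<forall>y\<in>F. R y m \<longrightarrow> y = m"
    using insert.IH antisym trans by blast
  show ?case
  proof (cases "R x m")
    case True
    have "y = x" if "y \<in> F" "R y x" for y
    proof -
      have "R y m"
        using trans[of y x m] that True m(1) by blast
      then have "y = m"
        using m(2) that(1) by blast
      then show ?thesis
        using antisym[of x m] True that(2) m(1) by blast
    qed
    then show ?thesis
      by blast
  next
    case False
    then show ?thesis
      using m by blast
  qed
qed

lemma poset_finite_has_minimal:
  assumes "is_poset Q" "finite X" "X \<noteq> {}" "X \<subseteq> fst Q"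
  shows "\<exists>m\<in>X. \<forall>y\<in>X. snd Q y m \<longrightarrow> y = m"
  by (rule finite_has_minimal_wrt[OF assms(2,3)]) (use assms(1,4) in \<open>unfold is_poset_def, blast+\<close>)

lemma poset_finite_has_maximal:
  assumes "is_poset Q" "finite X" "X \<noteq> {}" "X \<subseteq> fst Q"
  shows "\<exists>m\<in>X. \<forall>y\<in>X. snd Q m y \<longrightarrow> y = m"
  by (rule finite_has_minimal_wrt[OF assms(2,3), where R = "\<lambda>x y. snd Q y x"])
    (use assms(1,4) in \<open>unfold is_poset_def, blast+\<close>)

lemma poset_iso_if_card_le_1:
  assumes "is_poset P" "is_poset R" "finite (fst P)" "finite (fst R)"
    and "card (fst P) = card (fst R)" "card (fst P) \<le> 1"
  shows "poset_iso P R"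
proof (cases "card (fst P) = 0")
  case True
  then have "fst P = {}" "fst R = {}"
    using assms by simp_all
  then show ?thesis
    unfolding poset_iso_def by (simp add: bij_betw_def)
next
  case False
  then have "card (fst P) = 1" "card (fst R) = 1"
    using assms(5,6) by simp_all
  then obtain p r where "fst P = {p}" "fst R = {r}"
    by (meson card_1_singletonE)
  moreover have "snd P p p" "snd R r r"
    using assms(1,2) calculation unfolding is_poset_def by auto
  ultimately show ?thesis
    unfolding poset_iso_def by (intro exI[of _ "\<lambda>_. r"]) (simp add: bij_betw_def)
qed

lemma two_le_card_if_not_iso:
  assumes "is_poset P" "is_poset R" "finite (fst P)" "finite (fst R)"
    and "card (fst P) = card (fst R)" "\<not> poset_iso P R"
  shows "2 \<le> card (fst P)"
  using poset_iso_if_card_le_1[OF assms(1-5)] assms(6) by linarith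

lemma downset_Un: "is_downset Q A \<Longrightarrow> is_downset Q B \<Longrightarrow> is_downset Q (A \<union> B)"
  unfolding is_downset_def by blast

lemma downset_UN: "(\<And>i. i \<in> I \<Longrightarrow> is_downset Q (D i)) \<Longrightarrow> is_downset Q (\<Union>i\<in>I. D i)"
  unfolding is_downset_def by blast

lemma downset_Int: "is_downset Q A \<Longrightarrow> is_downset Q B \<Longrightarrow> is_downset Q (A \<inter> B)"
  unfolding is_downset_def by blast

lemma downset_of_subposet_iff:
  assumes "is_downset Q U"
  shows "is_downset (subposet Q U) D \<longleftrightarrow> is_downset Q D \<and> D \<subseteq> U"
  using assms unfolding is_downset_def subposet_def by auto

lemma downset_exchange:
  assumes "is_downset Q D" "x \<in> D" "\<forall>z\<in>D. snd Q x z \<longrightarrow> z = x"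
    and "y \<in> fst Q" "\<forall>w\<in>fst Q. snd Q w y \<longrightarrow> w = y \<or> w \<in> D - {x}"
  shows "is_downset Q (insert y (D - {x}))"
  using assms unfolding is_downset_def by (auto 0 3)

lemma downset_has_minimal_element:
  assumes "is_poset Q" "is_downset Q D" "finite D" "D \<noteq> {}"
  obtains a where "a \<in> D" "\<forall>w\<in>fst Q. snd Q w a \<longrightarrow> w = a"
proof -
  have "D \<subseteq> fst Q"
    using assms(2) unfolding is_downset_def by blast
  then obtain a where "a \<in> D" "\<forall>y\<in>D. snd Q y a \<longrightarrow> y = a"
    using poset_finite_has_minimal[OF assms(1,3,4)] by blast
  then show ?thesis
    using that assms(2) unfolding is_downset_def by blast
qed

lemma downset_replace_maximal:
  assumes "is_poset Q" "is_downset Q C" "finite C" "C \<noteq> {}"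
    and "a \<in> fst Q" "\<forall>w\<in>fst Q. snd Q w a \<longrightarrow> w = a"
  obtains c where "c \<in> C" "is_downset Q (insert a (C - {c}))"
proof -
  have "C \<subseteq> fst Q"
    using assms(2) unfolding is_downset_def by blast
  then obtain c where c: "c \<in> C" "\<forall>z\<in>C. snd Q c z \<longrightarrow> z = c"
    using poset_finite_has_maximal[OF assms(1,3,4)] by blast
  then show ?thesis
    using that downset_exchange[OF assms(2) c] assms(5,6) by blast
qed

lemma downset_exchange_toward:
  assumes "is_poset Q" "is_downset Q A" "is_downset Q B" "finite A" "finite B"
    and "card A = card B" "A - B \<noteq> {}"
  obtains A' where "is_downset Q A'" "card A' = card A" "card (A - A') = 1" "card (A' - B) < card (A - B)"
proof -
  have "B - A \<noteq> {}"
  proof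
    assume "B - A = {}"
    then have "B \<subseteq> A"
      by blast
    then have "B = A"
      using card_subset_eq[OF assms(4) _ assms(6)[symmetric]] by blast
    then show False
      using assms(7) by blast
  qed
  have "A - B \<subseteq> fst Q" "B - A \<subseteq> fst Q"
    using assms(2,3) unfolding is_downset_def by blast+
  obtain x where x: "x \<in> A - B" "\<forall>z\<in>A - B. snd Q x z \<longrightarrow> z = x"
    using poset_finite_has_maximal[OF assms(1) finite_Diff[OF assms(4)] assms(7)] \<open>A - B \<subseteq> fst Q\<close>
    by blast
  obtain y where y: "y \<in> B - A" "\<forall>w\<in>B - A. snd Q w y \<longrightarrow> w = y"
    using poset_finite_has_minimal[OF assms(1) finite_Diff[OF assms(5)] \<open>B - A \<noteq> {}\<close>]
      \<open>B - A \<subseteq> fst Q\<close> by blast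
  have x_max: "\<forall>z\<in>A. snd Q x z \<longrightarrow> z = x"
    using x assms(2,3) unfolding is_downset_def by blast
  have y_min: "\<forall>w\<in>fst Q. snd Q w y \<longrightarrow> w = y \<or> w \<in> A - {x}"
    using x y assms(3) unfolding is_downset_def by blast
  have "is_downset Q (insert y (A - {x}))"
    using downset_exchange[OF assms(2) _ x_max _ y_min] x y \<open>B - A \<subseteq> fst Q\<close> by blast
  moreover have "card (insert y (A - {x})) = card A"
    using x y assms(4) card_Suc_Diff1[of A x] by simp
  moreover have "card (A - insert y (A - {x})) = 1"
  proof -
    have "A - insert y (A - {x}) = {x}"
      using x y by auto
    then show ?thesis
      by simp
  qed
  moreover have "card (insert y (A - {x}) - B) < card (A - B)"
  proof -
    have "insert y (A - {x}) - B = (A - B) - {x}"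
      using y by auto
    then show ?thesis
      using x assms(4) card_Diff1_less[of "A - B" x] by simp
  qed
  ultimately show ?thesis
    by (rule that)
qed

locale poset_witness =
  fixes \<Gamma> :: "'b poset set" and n :: nat and Q :: "'a poset"
  assumes poset: "is_poset Q"
    and finite_carrier: "finite (fst Q)"
    and witness: "is_witness \<Gamma> n Q"
begin

lemma finite_downset: "is_downset Q D \<Longrightarrow> finite D"
  using finite_carrier finite_subset unfolding is_downset_def by blast

lemma downset_realizes_type:
  assumes "is_downset Q D" "card D = n"
  obtains P where "P \<in> \<Gamma>" "realizes Q n D P"
  using witness assms finite_downset[OF assms(1)] unfolding is_witness_def realizes_def by blast

lemma type_realized:
  assumes "P \<in> \<Gamma>"
  obtains D where "realizes Q n D P"
  using witness assms unfolding is_witness_def realizes_def by blast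

lemma exists_close_realizations:
  assumes "realizes Q n A P1" "realizes Q n B P2" "P1 \<in> \<Gamma>" "P2 \<in> \<Gamma>" "P1 \<noteq> P2"
  shows "\<exists>A' B' P1' P2'. realizes Q n A' P1' \<and> realizes Q n B' P2' \<and>
    P1' \<in> \<Gamma> \<and> P2' \<in> \<Gamma> \<and> P1' \<noteq> P2' \<and> card (A' - B') \<le> 1"
  using assms
proof (induction "card (A - B)" arbitrary: A P1 rule: less_induct)
  case (less A P1)
  show ?case
  proof (cases "card (A - B) \<le> 1")
    case True
    then show ?thesis
      using less.prems by blast
  next
    case False
    then have "A - B \<noteq> {}"
      by (metis card.empty le0)
    have A: "is_downset Q A" "card A = n" and B: "is_downset Q B" "card B = n"
      using less.prems unfolding realizes_def by auto
    obtain A' where A': "is_downset Q A'" "card A' = card A" "card (A - A') = 1"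
      "card (A' - B) < card (A - B)"
      by (rule downset_exchange_toward[OF poset A(1) B(1) finite_downset[OF A(1)]
            finite_downset[OF B(1)] _ \<open>A - B \<noteq> {}\<close>]) (use A B in simp_all)
    obtain P where P: "P \<in> \<Gamma>" "realizes Q n A' P"
      using downset_realizes_type[OF A'(1)] A'(2) A(2) by metis
    show ?thesis
    proof (cases "P = P2")
      case True
      have "card (A - A') \<le> 1"
        using A'(3) by simp
      then show ?thesis
        using less.prems P True by blast
    next
      case False
      show ?thesis
        by (rule less.hyps[OF A'(4) P(2) less.prems(2) P(1) less.prems(4) False])
    qed
  qed
qed

lemma three_types_in_union:
  assumes "realizes Q n D1 R1" "realizes Q n D2 R2" "realizes Q n D3 R3"
    and "R1 \<in> \<Gamma>" "R2 \<in> \<Gamma>" "R3 \<in> \<Gamma>" "R1 \<noteq> R2" "R1 \<noteq> R3" "R2 \<noteq> R3"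
    and "card (D1 \<union> D2 \<union> D3) \<le> 2 * n"
  obtains U S where "is_downset Q U" "card U \<le> 2 * n" "S \<subseteq> \<Gamma>" "card S = 3"
    "\<forall>P\<in>S. \<exists>D\<subseteq>U. realizes Q n D P"
proof (rule that[of "D1 \<union> D2 \<union> D3" "{R1, R2, R3}"])
  show "is_downset Q (D1 \<union> D2 \<union> D3)"
    using assms(1-3) unfolding realizes_def by (blast intro: downset_Un)
  show "\<forall>P\<in>{R1, R2, R3}. \<exists>D\<subseteq>D1 \<union> D2 \<union> D3. realizes Q n D P"
    using assms(1-3) by blast
qed (use assms(4-10) in auto)

lemma three_types_within_if_disjoint:
  assumes "2 \<le> n"
    and A: "realizes Q n A P1" and B: "realizes Q n B P2" and C: "realizes Q n C P3"
    and types: "P1 \<in> \<Gamma>" "P2 \<in> \<Gamma>" "P3 \<in> \<Gamma>" "P1 \<noteq> P2" "P1 \<noteq> P3" "P2 \<noteq> P3"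
    and close: "card (A - B) \<le> 1" and disjoint: "C \<inter> (A \<union> B) = {}"
  obtains U S where "is_downset Q U" "card U \<le> 2 * n" "S \<subseteq> \<Gamma>" "card S = 3"
    "\<forall>P\<in>S. \<exists>D\<subseteq>U. realizes Q n D P"
proof -
  have dA: "is_downset Q A" "card A = n" and dB: "is_downset Q B" "card B = n"
    and dC: "is_downset Q C" "card C = n"
    using A B C unfolding realizes_def by auto
  have fin: "finite A" "finite B" "finite C"
    using dA dB dC finite_downset by auto
  have "card A = card (A \<inter> B) + card (A - B)"
    using card_Int_Diff[OF fin(1)] .
  then have "A \<inter> B \<noteq> {}"
    using dA(2) close assms(1) by auto
  then obtain a where a: "a \<in> A \<inter> B" "\<forall>w\<in>fst Q. snd Q w a \<longrightarrow> w = a"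
    using downset_has_minimal_element[OF poset downset_Int[OF dA(1) dB(1)]] fin by blast
  have "C \<noteq> {}" "a \<in> fst Q"
    using dC(2) assms(1) a(1) dA(1) unfolding is_downset_def by auto
  then obtain c where c: "c \<in> C" "is_downset Q (insert a (C - {c}))"
    using downset_replace_maximal[OF poset dC(1) fin(3) _ _ a(2)] by blast
  define E where "E = insert a (C - {c})"
  have "card (C - {c}) = n - 1"
    using c(1) fin(3) dC(2) by simp
  moreover have "a \<notin> C"
    using disjoint a(1) by blast
  ultimately have "card E = n"
    unfolding E_def using fin(3) assms(1) by simp
  then obtain P where P: "P \<in> \<Gamma>" "realizes Q n E P"
    using downset_realizes_type c(2) unfolding E_def by blast
  consider "P = P1" | "P = P2" | "P \<noteq> P1" "P \<noteq> P2"
    by blast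
  then show ?thesis
  proof cases
    case 1
    have "E \<union> B \<union> C = B \<union> C"
      using a c(1) unfolding E_def by blast
    then have "card (E \<union> B \<union> C) \<le> 2 * n"
      using card_Un_le[of B C] dB(2) dC(2) by simp
    then show ?thesis
      using three_types_in_union[OF P(2) B C P(1) types(2,3)] 1 types that by blast
  next
    case 2
    have "A \<union> E \<union> C = A \<union> C"
      using a c(1) unfolding E_def by blast
    then have "card (A \<union> E \<union> C) \<le> 2 * n"
      using card_Un_le[of A C] dA(2) dC(2) by simp
    then show ?thesis
      using three_types_in_union[OF A P(2) C types(1) P(1) types(3)] 2 types that by blast
  next
    case 3
    have "A \<union> B \<union> E = (A \<union> B) \<union> (C - {c})"
      using a unfolding E_def by blast
    moreover have "card (A \<union> B) \<le> n + 1"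
      using card_Un_Diff[OF fin(1,2)] dB(2) close by simp
    ultimately have "card (A \<union> B \<union> E) \<le> 2 * n"
      using card_Un_le[of "A \<union> B" "C - {c}"] \<open>card (C - {c}) = n - 1\<close> assms(1) by simp
    then show ?thesis
      using three_types_in_union[OF A B P(2) types(1,2) P(1) types(4)] 3 that by blast
  qed
qed

lemma three_types_within:
  assumes "2 \<le> n"
    and A: "realizes Q n A P1" and B: "realizes Q n B P2" and C: "realizes Q n C P3"
    and types: "P1 \<in> \<Gamma>" "P2 \<in> \<Gamma>" "P3 \<in> \<Gamma>" "P1 \<noteq> P2" "P1 \<noteq> P3" "P2 \<noteq> P3"
    and close: "card (A - B) \<le> 1"
  obtains U S where "is_downset Q U" "card U \<le> 2 * n" "S \<subseteq> \<Gamma>" "card S = 3"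
    "\<forall>P\<in>S. \<exists>D\<subseteq>U. realizes Q n D P"
proof (cases "C \<inter> (A \<union> B) = {}")
  case True
  then show ?thesis
    using three_types_within_if_disjoint[OF assms] that by blast
next
  case False
  have fin: "finite A" "finite B" "finite C" and card: "card B = n" "card C = n"
    using A B C finite_downset unfolding realizes_def by auto
  have "card (C - (A \<union> B)) < card C"
    by (rule psubset_card_mono) (use fin False in auto)
  then have "card (A \<union> B \<union> C) \<le> 2 * n"
    using card_Un_Diff[of C "A \<union> B"] card_Un_Diff[OF fin(1,2)] fin card close
    by (simp add: Un_commute)
  then show ?thesis
    using three_types_in_union[OF A B C types] that by blast
qed

lemma exists_three_types_within:
  assumes "2 \<le> n" "3 \<le> card \<Gamma>"
  obtains U S where "is_downset Q U" "card U \<le> 2 * n" "S \<subseteq> \<Gamma>" "card S = 3"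
    "\<forall>P\<in>S. \<exists>D\<subseteq>U. realizes Q n D P"
proof -
  obtain P1 where "P1 \<in> \<Gamma>"
    using obtain_element_outside[of "{}" \<Gamma>] assms(2) by auto
  moreover obtain P2 where "P2 \<in> \<Gamma>" "P2 \<noteq> P1"
    using obtain_element_outside[of "{P1}" \<Gamma>] assms(2) by auto
  moreover obtain A B where "realizes Q n A P1" "realizes Q n B P2"
    using type_realized \<open>P1 \<in> \<Gamma>\<close> \<open>P2 \<in> \<Gamma>\<close> by metis
  ultimately obtain A' B' P1' P2' where close: "realizes Q n A' P1'" "realizes Q n B' P2'"
    "P1' \<in> \<Gamma>" "P2' \<in> \<Gamma>" "P1' \<noteq> P2'" "card (A' - B') \<le> 1"
    using exists_close_realizations by metis
  have "card {P1', P2'} < card \<Gamma>"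
    using assms(2) close(5) by simp
  then obtain P3 where P3: "P3 \<in> \<Gamma>" "P3 \<noteq> P1'" "P3 \<noteq> P2'"
    using obtain_element_outside[of "{P1', P2'}" \<Gamma>] by blast
  then obtain C where "realizes Q n C P3"
    using type_realized by metis
  then show ?thesis
    using three_types_within[OF assms(1) close(1,2) _ close(3,4) P3(1) close(5)
        P3(2,3)[symmetric] close(6)] that by blast
qed

lemma witness_subposet:
  assumes "is_downset Q U" "\<forall>P\<in>\<Gamma>. \<exists>D\<subseteq>U. realizes Q n D P"
  shows "is_witness \<Gamma> n (subposet Q U)"
  unfolding is_witness_def downset_of_subposet_iff[OF assms(1)]
proof (intro conjI allI ballI impI)
  fix D
  assume "(is_downset Q D \<and> D \<subseteq> U) \<and> finite D \<and> card D = n"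
  then show "\<exists>P\<in>\<Gamma>. poset_iso (subposet (subposet Q U) D) P"
    using downset_realizes_type unfolding realizes_def subposet_def by (metis fst_conv snd_conv)
next
  fix P
  assume "P \<in> \<Gamma>"
  then obtain D where "D \<subseteq> U" "realizes Q n D P"
    using assms(2) by blast
  then show "\<exists>D. (is_downset Q D \<and> D \<subseteq> U) \<and> finite D \<and> card D = n \<and>
      poset_iso (subposet (subposet Q U) D) P"
    using finite_downset unfolding realizes_def subposet_def by auto
qed

lemma card_carrier_le_if_minimal:
  assumes "is_minimal_witness \<Gamma> n Q" "finite \<Gamma>" "S \<subseteq> \<Gamma>"
    and "is_downset Q U" "\<forall>P\<in>S. \<exists>D\<subseteq>U. realizes Q n D P"
  shows "card (fst Q) \<le> card U + n * card (\<Gamma> - S)"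
proof -
  have "\<forall>P\<in>\<Gamma> - S. \<exists>D. realizes Q n D P"
    using type_realized by blast
  then obtain D where D: "\<forall>P\<in>\<Gamma> - S. realizes Q n (D P) P"
    by (rule bchoice[THEN exE])
  define V where "V = U \<union> (\<Union>P\<in>\<Gamma> - S. D P)"
  have "is_downset Q V"
    unfolding V_def using assms(4) D by (intro downset_Un downset_UN) (simp_all add: realizes_def)
  moreover have "\<exists>D'\<subseteq>V. realizes Q n D' P" if "P \<in> \<Gamma>" for P
  proof (cases "P \<in> S")
    case True
    then obtain D' where "D' \<subseteq> U" "realizes Q n D' P"
      using assms(5) by blast
    then show ?thesis
      unfolding V_def by blast
  next
    case False
    then have "realizes Q n (D P) P"
      using D that by blast
    moreover have "D P \<subseteq> V"
      using False that unfolding V_def by blast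
    ultimately show ?thesis
      by blast
  qed
  ultimately have "is_witness \<Gamma> n (subposet Q V)"
    by (intro witness_subposet) auto
  then have "V = fst Q"
    using assms(1) \<open>is_downset Q V\<close> unfolding is_minimal_witness_def by blast
  have "(\<Sum>P\<in>\<Gamma> - S. card (D P)) = (\<Sum>P\<in>\<Gamma> - S. n)"
    using D unfolding realizes_def by (intro sum.cong) auto
  have "card (fst Q) = card (U \<union> (\<Union>P\<in>\<Gamma> - S. D P))"
    using \<open>V = fst Q\<close> unfolding V_def by simp
  also have "\<dots> \<le> card U + card (\<Union>P\<in>\<Gamma> - S. D P)"
    by (rule card_Un_le)
  also have "\<dots> \<le> card U + (\<Sum>P\<in>\<Gamma> - S. card (D P))"
    using card_UN_le[of "\<Gamma> - S" D] assms(2) by simp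
  also have "\<dots> = card U + n * card (\<Gamma> - S)"
    using \<open>(\<Sum>P\<in>\<Gamma> - S. card (D P)) = (\<Sum>P\<in>\<Gamma> - S. n)\<close> by simp
  finally show ?thesis .
qed

end

theorem mainTheorem12:
  fixes \<Gamma> :: "'b poset set" and Q :: "'a poset" and n k :: nat
  assumes "finite \<Gamma>" and "card \<Gamma> = k" and "k \<ge> 3"
    and "\<forall>P\<in>\<Gamma>. is_poset P \<and> finite (fst P) \<and> card (fst P) = n"
    and "\<forall>P\<in>\<Gamma>. \<forall>R\<in>\<Gamma>. P \<noteq> R \<longrightarrow> \<not> poset_iso P R"
    and "is_poset Q" and "finite (fst Q)"
    and "is_minimal_witness \<Gamma> n Q"
  shows "card (fst Q) \<le> n * (k - 1)"
proof -
  interpret poset_witness \<Gamma> n Q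
    using assms(6-8) by unfold_locales (auto simp: is_minimal_witness_def)
  have "3 \<le> card \<Gamma>"
    using assms(2,3) by simp
  obtain P where "P \<in> \<Gamma>"
    using obtain_element_outside[of "{}" \<Gamma>] \<open>3 \<le> card \<Gamma>\<close> by auto
  moreover obtain R where "R \<in> \<Gamma>" "R \<noteq> P"
    using obtain_element_outside[of "{P}" \<Gamma>] \<open>3 \<le> card \<Gamma>\<close> by auto
  ultimately have "2 \<le> n"
    using two_le_card_if_not_iso assms(4,5) by metis
  obtain U S where U: "is_downset Q U" "card U \<le> 2 * n" "S \<subseteq> \<Gamma>" "card S = 3"
    "\<forall>P\<in>S. \<exists>D\<subseteq>U. realizes Q n D P"
    by (rule exists_three_types_within[OF \<open>2 \<le> n\<close> \<open>3 \<le> card \<Gamma>\<close>])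
  have "card (fst Q) \<le> card U + n * card (\<Gamma> - S)"
    by (rule card_carrier_le_if_minimal[OF assms(8,1) U(3,1,5)])
  moreover have "card (\<Gamma> - S) = k - 3"
    using U(3,4) assms(1,2) by (simp add: card_Diff_subset finite_subset)
  moreover have "n * 3 \<le> n * k"
    using assms(3) by simp
  ultimately show ?thesis
    using U(2) by (simp add: diff_mult_distrib2)
qed

end
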